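(* If $qS\ge 0$ is a superbalanced facet of $H_n$, then any zero-lift $q'S'\ge 0$ of it is a superbalanced facet of $H_{n+1}$.
   Context: For a positive integer $k$ let $[k]=\{1,\dots,k\}$. $K_N$ is the undirected complete graph on vertex set $[N]$, with edge set $E_N$. A weight map is a function $w:E_N\to\mathbb{R}_{\ge 0}$. For $W\subseteq[N]$, the cut $C(W)$ is the set of edges with exactly one endpoint in $W$, and $\|C(W)\|$ is the sum of the weights of its edges. For $1\le n<N$, $w$ realizes in $K_N$ the vector $S=(S_I)_{\varnothing\ne I\subseteq[n]}\in\mathbb{R}^{2^n-1}$ with $S_I=\min\{\|C(W)\| : W\subseteq[N-1],\ W\cap[n]=I\}$. $H_n$ is the set of all $S\in\mathbb{R}^{2^n-1}$ realized by some weight map in $K_N$ for some $N>n$; it is a full-dimensional convex polyhedral cone. An inequality $qS\ge0$ with $q=(q_I)_{\varnothing\ne I\subseteq[n]}\in\mathbb{R}^{2^n-1}$ means $\sum_I q_IS_I\ge 0$. It is a facet of $H_n$ if it holds for all $S\in H_n$ and $\{S\in H_n: qS=0\}$ is a facet of $H_n$, i.e. has dimension $2^n-2$. The inequality is balanced if $\sum_{I\ni j}q_I=0$ for every $j\in[n]$. The sink is denoted $N\notin[n]$ and $[n;N]=[n]\cup\{N\}$. For a non-empty proper subset $X$ of $[n;N]$ containing $N$ one sets $S_X:=S_{[n;N]\setminus X}$. A permutation $\pi$ of $[n;N]$ sends the inequality $\sum_Iq_IS_I\ge0$ to $\sum_Iq_IS_{\pi(I)}\ge0$. A balanced inequality is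 superbalanced if all inequalities obtained from it by permutations of $[n;N]$ are balanced. Zero-lift: let $K\subseteq[n]$ be the set of terminals appearing in $qS\ge0$ ($i\in K$ iff $q_I\neq0$ for some $I\ni i$). Given a family of pairwise disjoint non-empty subsets $I_i\subseteq[n+1]$, $i\in K$ (whose union need not be $[n+1]$), the corresponding zero-lift $q'S'\ge0$, an inequality over $\mathbb{R}^{2^{n+1}-1}$, is obtained by replacing each term $q_IS_I$ with $q_I\neq0$ by $q_IS'_{\bigcup_{i\in I}I_i}$. *)

theory Defs
  imports "HOL-Analysis.Analysis" "HOL-Library.Function_Algebras"
    "HOL-Combinatorics.Permutations"
begin

subsection \<open>Functions as a real vector space\<close>

instantiation "fun" :: (type, real_vector) real_vector
begin

definition scaleR_fun :: "real \<Rightarrow> ('a \<Rightarrow> 'b) \<Rightarrow> 'a \<Rightarrow> 'b"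
  where "scaleR_fun c f = (\<lambda>x. c *\<^sub>R f x)"

instance
  by standard (auto simp: scaleR_fun_def fun_eq_iff scaleR_add_right scaleR_add_left)

end

text \<open>
  The library's \<open>aff_dim\<close> requires class \<open>euclidean_space\<close>, which function types
  do not belong to. Here the dimension of a non-empty set is the dimension of the direction
  space of its affine hull, i.e. of the span of all differences of its elements.
\<close>

definition affine_dim :: "'a::real_vector set \<Rightarrow> nat"
  where "affine_dim A = dim {x - y |x y. x \<in> A \<and> y \<in> A}"

lemma affine_dim_eq_aff_dim:
  fixes A :: "'a::euclidean_space set"
  assumes "A \<noteq> {}"
  shows "int (affine_dim A) = aff_dim A"
proof -
  obtain a where a: "a \<in> A" using assms by blast
  have "span {x - y |x y. x \<in> A \<and> y \<in> A} = span ((\<lambda>x. - a + x) ` A)" (is "span ?D = span ?T")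
  proof (rule antisym)
    show "span ?T \<subseteq> span ?D"
      by (rule span_mono) (use a in force)
    have "x - y \<in> span ?T" if "x \<in> A" "y \<in> A" for x y
    proof -
      have "(- a + x) - (- a + y) \<in> span ?T"
        using that by (intro span_diff span_base) auto
      then show ?thesis by simp
    qed
    then show "span ?D \<subseteq> span ?T"
      by (intro span_minimal) auto
  qed
  then have "dim ?D = dim ?T" by (rule span_eq_dim)
  with aff_dim_eq_dim[OF hull_inc[OF a, of affine]] show ?thesis
    by (simp add: affine_dim_def)
qed


subsection \<open>The cone of realizable minimum cut vectors\<close>

definition index_sets :: "nat \<Rightarrow> nat set set"
  where "index_sets n = {I. I \<subseteq> {1..n} \<and> I \<noteq> {}}"

text \<open>
  The space of real vectors indexed by the \<open>2 ^ n - 1\<close> non-empty subsets of \<open>{1..n}\<close>; entries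
  at all other sets are fixed to be 0, so that equality of functions is equality of vectors.
\<close>

definition cut_space :: "nat \<Rightarrow> (nat set \<Rightarrow> real) set"
  where "cut_space n = {S. \<forall>I. I \<notin> index_sets n \<longrightarrow> S I = 0}"

definition edges :: "nat \<Rightarrow> nat set set"
  where "edges N = {{u, v} |u v. u \<in> {1..N} \<and> v \<in> {1..N} \<and> u \<noteq> v}"

definition weight_map :: "nat \<Rightarrow> (nat set \<Rightarrow> real) \<Rightarrow> bool"
  where "weight_map N w \<longleftrightarrow> (\<forall>e\<in>edges N. w e \<ge> 0)"

definition cut :: "nat \<Rightarrow> nat set \<Rightarrow> nat set set"
  where "cut N W = {e \<in> edges N. card (e \<inter> W) = 1}"

definition cut_weight :: "nat \<Rightarrow> (nat set \<Rightarrow> real) \<Rightarrow> nat set \<Rightarrow> real"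
  where "cut_weight N w W = (\<Sum>e\<in>cut N W. w e)"

definition realizes :: "nat \<Rightarrow> nat \<Rightarrow> (nat set \<Rightarrow> real) \<Rightarrow> (nat set \<Rightarrow> real) \<Rightarrow> bool"
  where "realizes n N w S \<longleftrightarrow>
    S \<in> cut_space n \<and>
    (\<forall>I\<in>index_sets n. S I = Min (cut_weight N w ` {W. W \<subseteq> {1..N - 1} \<and> W \<inter> {1..n} = I}))"

definition H :: "nat \<Rightarrow> (nat set \<Rightarrow> real) set"
  where "H n = {S. \<exists>N>n. \<exists>w. weight_map N w \<and> realizes n N w S}"


subsection \<open>Inequalities\<close>

text \<open>An inequality \<open>qS \<ge> 0\<close> is represented by its coefficient vector \<open>q\<close>.\<close>

definition ineq_lhs :: "nat \<Rightarrow> (nat set \<Rightarrow> real) \<Rightarrow> (nat set \<Rightarrow> real) \<Rightarrow> real"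
  where "ineq_lhs n q S = (\<Sum>I\<in>index_sets n. q I * S I)"

text \<open>The set in the last conjunct contains the zero vector, hence is never empty.\<close>

definition is_facet :: "nat \<Rightarrow> (nat set \<Rightarrow> real) \<Rightarrow> bool"
  where "is_facet n q \<longleftrightarrow>
    q \<in> cut_space n \<and>
    (\<forall>S\<in>H n. ineq_lhs n q S \<ge> 0) \<and>
    affine_dim {S \<in> H n. ineq_lhs n q S = 0} = 2 ^ n - 2"

definition balanced :: "nat \<Rightarrow> (nat set \<Rightarrow> real) \<Rightarrow> bool"
  where "balanced n q \<longleftrightarrow> (\<forall>j\<in>{1..n}. (\<Sum>I | I \<in> index_sets n \<and> j \<in> I. q I) = 0)"

text \<open>
  The index of the coordinate denoted by \<open>S\<^sub>X\<close>, for a non-empty proper subset \<open>X\<close> of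
  \<open>{1..n} \<union> {N}\<close>, where \<open>N > n\<close> is the sink: sets containing the sink are complemented.
\<close>

definition coord_index :: "nat \<Rightarrow> nat \<Rightarrow> nat set \<Rightarrow> nat set"
  where "coord_index n N X = (if N \<in> X then insert N {1..n} - X else X)"

text \<open>
  The coefficients of \<open>\<Sum>I. q\<^sub>I S\<^bsub>\<pi>(I)\<^esub> \<ge> 0\<close>, collected by coordinate.
\<close>

definition permute_ineq ::
    "nat \<Rightarrow> nat \<Rightarrow> (nat \<Rightarrow> nat) \<Rightarrow> (nat set \<Rightarrow> real) \<Rightarrow> nat set \<Rightarrow> real"
  where "permute_ineq n N \<pi> q =
    (\<lambda>J. \<Sum>I | I \<in> index_sets n \<and> coord_index n N (\<pi> ` I) = J. q I)"

text \<open>The sink is an arbitrary label \<open>N > n\<close>; the condition does not depend on its choice.\<close>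

definition superbalanced :: "nat \<Rightarrow> (nat set \<Rightarrow> real) \<Rightarrow> bool"
  where "superbalanced n q \<longleftrightarrow>
    balanced n q \<and>
    (\<forall>N>n. \<forall>\<pi>. \<pi> permutes insert N {1..n} \<longrightarrow> balanced n (permute_ineq n N \<pi> q))"


subsection \<open>Zero-lifts\<close>

definition terminals :: "nat \<Rightarrow> (nat set \<Rightarrow> real) \<Rightarrow> nat set"
  where "terminals n q = {i \<in> {1..n}. \<exists>I\<in>index_sets n. q I \<noteq> 0 \<and> i \<in> I}"

definition lift_family :: "nat \<Rightarrow> (nat set \<Rightarrow> real) \<Rightarrow> (nat \<Rightarrow> nat set) \<Rightarrow> bool"
  where "lift_family n q B \<longleftrightarrow>
    (\<forall>i\<in>terminals n q. B i \<noteq> {} \<and> B i \<subseteq> {1..n + 1}) \<and>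
    disjoint_family_on B (terminals n q)"

definition zero_lift ::
    "nat \<Rightarrow> (nat set \<Rightarrow> real) \<Rightarrow> (nat \<Rightarrow> nat set) \<Rightarrow> nat set \<Rightarrow> real"
  where "zero_lift n q B =
    (\<lambda>J. \<Sum>I | I \<in> index_sets n \<and> q I \<noteq> 0 \<and> (\<Union>i\<in>I. B i) = J. q I)"

end

theory Submission
  imports Defs
begin

text \<open>
  Superbalancedness says that the inequality is tight at every single edge between two terminals
  (sink included). The blocks of a zero-lift, together with the sink block formed by the remaining
  terminals, partition the terminals, and the lifted inequality only involves unions of blocks.
  Contracting the blocks gives validity. For the dimension, let \<open>F'\<close> be the lifted face.
  If a set \<open>J\<close> separates two terminals \<open>a\<close> and \<open>z\<close> of one block, take stars in which
  \<open>a\<close> and \<open>z\<close> together carry half of the total weight: on sets not separating \<open>a\<close> from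
  \<open>z\<close> they look like sums of edges, so they lie in \<open>F'\<close>, and by Moebius inversion the
  unit vector of \<open>J\<close> lies in the span of such stars and edges. On unions of blocks, networks on
  the original face, with each terminal placed at a representative of its block, show that
  \<open>F'\<close> projects onto the original hyperplane. Hence \<open>F'\<close> spans the lifted hyperplane.
\<close>

section \<open>Linear algebra\<close>

lemma affine_dim_eq_dim_of_zero_mem:
  fixes A :: "'a::real_vector set"
  assumes "0 \<in> A"
  shows "affine_dim A = dim A"
proof -
  have "span {x - y |x y. x \<in> A \<and> y \<in> A} = span A"
  proof (rule antisym)
    show "span {x - y |x y. x \<in> A \<and> y \<in> A} \<subseteq> span A"
      by (intro span_minimal) (auto intro: span_diff span_base)
    show "span A \<subseteq> span {x - y |x y. x \<in> A \<and> y \<in> A}"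
      by (rule span_mono) (use assms in force)
  qed
  then show ?thesis
    unfolding affine_dim_def by (rule real_vector.span_eq_dim)
qed

lemma hyperplane_card_basis:
  fixes E b :: "'a::real_vector set" and f :: "'a \<Rightarrow> real"
  assumes E: "finite E" "independent E" and f: "linear f"
    and b: "independent b" "b \<subseteq> span E" "\<And>x. x \<in> b \<Longrightarrow> f x = 0"
    and v: "v \<in> span E" "f v \<noteq> 0"
  shows "Suc (card b) = card E \<longleftrightarrow> (\<forall>x\<in>span E. f x = 0 \<longrightarrow> x \<in> span b)"
proof -
  interpret f: linear f by (rule f)
  have fin: "finite b"
    using independent_span_bound[OF E(1) b(1,2)] by simp
  have vb: "f x = 0" if "x \<in> span b" for x
    using that by (induction rule: span_induct_alt) (auto simp: f.add f.scale b(3))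
  then have vnb: "v \<notin> span b" using v(2) by blast
  then have ind: "independent (insert v b)"
    using b(1) by (simp add: independent_insert)
  have "v \<notin> b" using vnb span_base by blast
  then have c: "card (insert v b) = Suc (card b)" using fin by simp
  have sub: "insert v b \<subseteq> span E" using b(2) v(1) by simp
  have le: "Suc (card b) \<le> card E"
    using independent_span_bound[OF E(1) ind sub] c by simp
  show "Suc (card b) = card E \<longleftrightarrow> (\<forall>x\<in>span E. f x = 0 \<longrightarrow> x \<in> span b)"
  proof (intro iffI ballI impI)
    fix x assume eq: "Suc (card b) = card E" and x: "x \<in> span E" "f x = 0"
    show "x \<in> span b"
    proof (rule ccontr)
      assume nx: "x \<notin> span b"
      then have ix: "independent (insert x b)" using b(1) by (simp add: independent_insert)
      have vx: "f y = 0" if "y \<in> span (insert x b)" for y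
        using that by (induction rule: span_induct_alt) (auto simp: f.add f.scale b(3) x(2))
      then have nv: "v \<notin> span (insert x b)" using v(2) by blast
      then have iv: "independent (insert v (insert x b))"
        using ix by (simp add: independent_insert)
      have "insert v (insert x b) \<subseteq> span E" using sub x by simp
      then have "card (insert v (insert x b)) \<le> card E"
        using independent_span_bound[OF E(1) iv] by simp
      moreover have "v \<notin> insert x b" using nv span_base by blast
      moreover have "x \<notin> b" using nx span_base by blast
      ultimately show False using eq fin by simp
    qed
  next
    assume all: "\<forall>x\<in>span E. f x = 0 \<longrightarrow> x \<in> span b"
    have "E \<subseteq> span (insert v b)"
    proof
      fix x assume "x \<in> E"
      then have xE: "x \<in> span E" by (rule span_base)
      define y where "y = x - (f x / f v) *\<^sub>R v"
      have "y \<in> span E" unfolding y_def by (intro span_diff span_scale xE v(1))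
      moreover have "f y = 0" using v(2) by (simp add: y_def f.diff f.scale)
      ultimately have "y \<in> span b" using all by blast
      then have "y \<in> span (insert v b)"
        using span_mono[OF subset_insertI] by blast
      then have "y + (f x / f v) *\<^sub>R v \<in> span (insert v b)"
        by (intro span_add span_scale) (simp_all add: span_base)
      then show "x \<in> span (insert v b)" by (simp add: y_def)
    qed
    then have "card E \<le> card (insert v b)"
      using independent_span_bound[of "insert v b" E] E fin by simp
    then show "Suc (card b) = card E" using le c by simp
  qed
qed

text \<open>Turns a dimension count into a spanning property, which linear maps between cut spaces
  can transport.\<close>

lemma dim_eq_hyperplane_iff:
  fixes E U :: "'a::real_vector set" and f :: "'a \<Rightarrow> real"
  assumes E: "finite E" "independent E" and f: "linear f"
    and U: "U \<subseteq> span E" "\<And>x. x \<in> U \<Longrightarrow> f x = 0"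
    and v: "v \<in> span E" "f v \<noteq> 0"
  shows "dim U = card E - 1 \<longleftrightarrow> (\<forall>x\<in>span E. f x = 0 \<longrightarrow> x \<in> span U)"
proof -
  obtain b where b: "b \<subseteq> U" "independent b" "U \<subseteq> span b" "card b = dim U"
    using basis_exists by blast
  have sp: "span b = span U"
    using span_mono[OF b(1)] span_minimal[OF b(3) subspace_span] by (rule antisym)
  have "b \<subseteq> span E" "\<And>x. x \<in> b \<Longrightarrow> f x = 0" using b(1) U by auto
  note * = hyperplane_card_basis[OF E f b(2) this v]
  have "0 < card E" using E(1) v by (auto simp: card_gt_0_iff linear_0[OF f])
  then have "dim U = card E - 1 \<longleftrightarrow> Suc (card b) = card E" using b(4) by linarith
  then show ?thesis by (simp only: * sp)
qed


section \<open>The space of cut vectors\<close>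

definition unit_vec :: "nat set \<Rightarrow> nat set \<Rightarrow> real"
  where "unit_vec J = (\<lambda>I. if I = J then 1 else 0)"

lemma scaleR_fun_apply [simp]: "(c *\<^sub>R f) x = c *\<^sub>R f x"
  by (simp add: scaleR_fun_def)

lemma sum_fun_apply: "(\<Sum>a\<in>A. f a) x = (\<Sum>a\<in>A. f a x)"
  for f :: "'a \<Rightarrow> 'b \<Rightarrow> 'c::comm_monoid_add"
  by (induction A rule: infinite_finite_induct) auto

lemma finite_index_sets [simp]: "finite (index_sets n)"
  by (rule finite_subset[of _ "Pow {1..n}"]) (auto simp: index_sets_def)

lemma card_index_sets: "card (index_sets n) = 2 ^ n - 1"
proof -
  have "index_sets n = Pow {1..n} - {{}}" by (auto simp: index_sets_def)
  then show ?thesis by (simp add: card_Pow)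
qed

lemma cut_space_expand:
  assumes "S \<in> cut_space n"
  shows "S = (\<Sum>J\<in>index_sets n. S J *\<^sub>R unit_vec J)"
proof
  fix I
  have "(\<Sum>J\<in>index_sets n. S J *\<^sub>R unit_vec J) I
      = (\<Sum>J\<in>index_sets n. if I = J then S J else 0)"
    unfolding sum_fun_apply by (rule sum.cong) (auto simp: unit_vec_def)
  also have "\<dots> = S I"
    using assms by (auto simp: cut_space_def)
  finally show "S I = (\<Sum>J\<in>index_sets n. S J *\<^sub>R unit_vec J) I" by simp
qed

lemma subspace_cut_space: "subspace (cut_space n)"
  unfolding subspace_def cut_space_def by simp

lemma span_unit_vecs: "span (unit_vec ` index_sets n) = cut_space n"
proof (rule antisym)
  show "span (unit_vec ` index_sets n) \<subseteq> cut_space n"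
    by (rule span_minimal[OF _ subspace_cut_space]) (auto simp: cut_space_def unit_vec_def)
  show "cut_space n \<subseteq> span (unit_vec ` index_sets n)"
  proof
    fix S assume "S \<in> cut_space n"
    then have "S = (\<Sum>J\<in>index_sets n. S J *\<^sub>R unit_vec J)" by (rule cut_space_expand)
    also have "\<dots> \<in> span (unit_vec ` index_sets n)"
      by (intro span_sum span_scale span_base imageI)
    finally show "S \<in> span (unit_vec ` index_sets n)" .
  qed
qed

lemma inj_unit_vec: "inj unit_vec"
proof (rule injI)
  fix I J assume "unit_vec I = unit_vec J"
  then have "unit_vec I I = unit_vec J I" by simp
  then show "I = J" by (simp add: unit_vec_def split: if_splits)
qed

lemma independent_unit_vecs: "independent (unit_vec ` index_sets n)"
proof (rule independent_if_scalars_zero)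
  show "finite (unit_vec ` index_sets n)" by simp
  fix c e assume *: "(\<Sum>x\<in>unit_vec ` index_sets n. c x *\<^sub>R x) = 0" and "e \<in> unit_vec ` index_sets n"
  then obtain J where J: "J \<in> index_sets n" "e = unit_vec J" by blast
  have "0 = (\<Sum>I\<in>index_sets n. c (unit_vec I) *\<^sub>R unit_vec I) J"
    using * by (simp add: sum.reindex inj_on_subset[OF inj_unit_vec] o_def)
  also have "\<dots> = (\<Sum>I\<in>index_sets n. if J = I then c (unit_vec I) else 0)"
    unfolding sum_fun_apply by (rule sum.cong) (auto simp: unit_vec_def)
  also have "\<dots> = c e" using J by simp
  finally show "c e = 0" by simp
qed

lemma card_unit_vecs: "card (unit_vec ` index_sets n) = 2 ^ n - 1"
  by (simp add: card_image inj_on_subset[OF inj_unit_vec] card_index_sets)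

lemma linear_ineq_lhs: "linear (ineq_lhs n q)"
proof (rule linearI)
  show "ineq_lhs n q (x + y) = ineq_lhs n q x + ineq_lhs n q y" for x y
    by (simp add: ineq_lhs_def distrib_left sum.distrib)
  show "ineq_lhs n q (c *\<^sub>R x) = c *\<^sub>R ineq_lhs n q x" for c x
    by (simp add: ineq_lhs_def sum_distrib_left mult.left_commute)
qed

lemma ineq_lhs_unit_vec:
  assumes "J \<in> index_sets n"
  shows "ineq_lhs n q (unit_vec J) = q J"
proof -
  have "ineq_lhs n q (unit_vec J) = (\<Sum>I\<in>index_sets n. if J = I then q I else 0)"
    unfolding ineq_lhs_def by (rule sum.cong) (auto simp: unit_vec_def)
  then show ?thesis using assms by simp
qed


section \<open>Networks\<close>

text \<open>Members of \<open>index_sets n\<close> contain neither 0 nor labels above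
  \<open>n\<close>, so a sink carrying such a label always lies outside and terminal-sink pairs need
  no separate case.\<close>

definition separates :: "nat set \<Rightarrow> nat \<Rightarrow> nat \<Rightarrow> bool"
  where "separates I u v \<longleftrightarrow> (u \<in> I) \<noteq> (v \<in> I)"

definition network_vec :: "nat \<Rightarrow> nat \<Rightarrow> (nat set \<Rightarrow> real) \<Rightarrow> nat set \<Rightarrow> real"
  where "network_vec n N w = (\<lambda>I. if I \<in> index_sets n
    then Min (cut_weight N w ` {W. W \<subseteq> {1..N - 1} \<and> W \<inter> {1..n} = I}) else 0)"

lemma realizes_iff: "realizes n N w S \<longleftrightarrow> S = network_vec n N w"
  by (auto simp: realizes_def network_vec_def cut_space_def fun_eq_iff)

lemma H_iff: "S \<in> H n \<longleftrightarrow> (\<exists>N>n. \<exists>w. weight_map N w \<and> S = network_vec n N w)"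
  by (simp add: H_def realizes_iff)

lemma H_subset_cut_space: "H n \<subseteq> cut_space n"
  by (auto simp: H_def realizes_def)

lemma card_edge_Int: "u \<noteq> v \<Longrightarrow> card ({u, v} \<inter> W) = 1 \<longleftrightarrow> separates W u v"
  by (auto simp: separates_def Int_insert_left)

lemma finite_edges [simp]: "finite (edges N)"
  by (rule finite_subset[of _ "Pow {1..N}"]) (auto simp: edges_def)

lemma finite_cut [simp]: "finite (cut N W)"
  by (simp add: cut_def)

lemma cut_weight_nonneg: "weight_map N w \<Longrightarrow> cut_weight N w W \<ge> 0"
  by (auto simp: cut_weight_def weight_map_def cut_def intro!: sum_nonneg)

lemma edge_mem_cut_iff:
  "{u, v} \<in> cut N W \<longleftrightarrow> u \<in> {1..N} \<and> v \<in> {1..N} \<and> u \<noteq> v \<and> separates W u v"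
proof (cases "u = v")
  case False
  have "{u, v} \<in> edges N \<longleftrightarrow> u \<in> {1..N} \<and> v \<in> {1..N}"
    using False by (auto simp: edges_def doubleton_eq_iff)
  then show ?thesis using card_edge_Int[OF False, of W] False by (auto simp: cut_def)
next
  case True
  then show ?thesis by (auto simp: cut_def edges_def)
qed

section \<open>Contracting and relabelling networks\<close>

text \<open>Edges contracted to a point are dropped, as \<open>edges N\<close> contains no singletons.\<close>

definition push_weights ::
    "nat \<Rightarrow> (nat \<Rightarrow> nat) \<Rightarrow> (nat set \<Rightarrow> real) \<Rightarrow> nat set \<Rightarrow> real"
  where "push_weights M \<rho> w = (\<lambda>e'. \<Sum>e | e \<in> edges M \<and> \<rho> ` e = e'. w e)"

lemma weight_map_push: "weight_map M w \<Longrightarrow> weight_map N (push_weights M \<rho> w)"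
  by (auto simp: weight_map_def push_weights_def intro!: sum_nonneg)

text \<open>An edge crosses the preimage of \<open>W\<close> exactly if its image is an edge
  crossing \<open>W\<close>; a contracted edge does neither. Grouping the edges by their image gives
  the equality.\<close>

lemma cut_weight_push:
  assumes \<rho>: "\<rho> ` {1..M} \<subseteq> {1..N}"
  shows "cut_weight N (push_weights M \<rho> w) W = cut_weight M w {u \<in> {1..M}. \<rho> u \<in> W}"
proof -
  have cut: "e \<in> edges M \<and> \<rho> ` e \<in> cut N W \<longleftrightarrow> e \<in> cut M {u \<in> {1..M}. \<rho> u \<in> W}" for e
  proof (cases "e \<in> edges M")
    case True
    then obtain u v where "e = {u, v}" "u \<in> {1..M}" "v \<in> {1..M}" "u \<noteq> v"
      by (auto simp: edges_def)
    moreover from this have "\<rho> u \<in> {1..N}" "\<rho> v \<in> {1..N}" using \<rho> by blast+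
    ultimately show ?thesis
      using True edge_mem_cut_iff[of "\<rho> u" "\<rho> v" N W]
        edge_mem_cut_iff[of u v M "{u \<in> {1..M}. \<rho> u \<in> W}"]
      by (simp add: separates_def) metis
  qed (simp add: cut_def)
  have "cut_weight N (push_weights M \<rho> w) W
      = (\<Sum>e'\<in>cut N W. sum w {e \<in> {e \<in> edges M. \<rho> ` e \<in> cut N W}. \<rho> ` e = e'})"
    unfolding cut_weight_def push_weights_def by (intro sum.cong) auto
  also have "\<dots> = sum w {e \<in> edges M. \<rho> ` e \<in> cut N W}"
    by (rule sum.group) auto
  also have "\<dots> = cut_weight M w {u \<in> {1..M}. \<rho> u \<in> W}"
    by (simp add: cut_weight_def cut)
  finally show ?thesis .
qed

text \<open>The map \<open>\<sigma>\<close> tells where each of \<open>m\<close> terminals goes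
  among \<open>n\<close> terminals, with 0 for the sink. Contracting blocks and placing terminals at
  representatives of blocks are both of this form.\<close>

definition pull_vec ::
    "nat \<Rightarrow> nat \<Rightarrow> (nat \<Rightarrow> nat) \<Rightarrow> (nat set \<Rightarrow> real) \<Rightarrow> nat set \<Rightarrow> real"
  where "pull_vec m n \<sigma> S =
    (\<lambda>I. if I \<in> index_sets n then S {u \<in> {1..m}. \<sigma> u \<in> I} else 0)"

lemma pull_vec_in_cut_space: "pull_vec m n \<sigma> S \<in> cut_space n"
  by (simp add: cut_space_def pull_vec_def)

lemma linear_pull_vec: "linear (pull_vec m n \<sigma>)"
  by (rule linearI) (auto simp: pull_vec_def fun_eq_iff)

text \<open>Relabel a network of \<open>S\<close> by \<open>\<rho>\<close>: terminals follow
  \<open>\<sigma>\<close>, the other vertices are shifted past the \<open>n\<close> new terminals.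
  Taking preimages maps the admissible sides of the new network onto those of the old one at equal
  cut weight, so the minima agree. New terminals outside the image of \<open>\<sigma>\<close> are
  isolated.\<close>

lemma pull_vec_in_H:
  assumes S: "S \<in> H m" and \<sigma>: "\<sigma> ` {1..m} \<subseteq> {0..n}"
  shows "pull_vec m n \<sigma> S \<in> H n"
proof -
  obtain M w where M: "M > m" and w: "weight_map M w" and S_eq: "S = network_vec m M w"
    using S by (auto simp: H_iff)
  \<comment> \<open>The shift takes the old sink \<open>M\<close> to \<open>N\<close>.\<close>
  define N where "N = M - m + n"
  define \<rho> where "\<rho> u = (if u \<le> m then if \<sigma> u = 0 then N else \<sigma> u else u - m + n)" for u
  have N: "N > n" using M by (simp add: N_def)
  have \<sigma>_le: "\<sigma> u \<le> n" if "1 \<le> u" "u \<le> m" for u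
    using subsetD[OF \<sigma>, of "\<sigma> u"] that by simp
  have \<rho>: "\<rho> ` {1..M} \<subseteq> {1..N}"
  proof
    fix y assume "y \<in> \<rho> ` {1..M}"
    then obtain u where u: "1 \<le> u" "u \<le> M" "y = \<rho> u" by auto
    show "y \<in> {1..N}"
      using u N M \<sigma>_le[of u] by (auto simp: \<rho>_def N_def split: if_splits)
  qed
  have eq: "network_vec n N (push_weights M \<rho> w) I = pull_vec m n \<sigma> S I" for I
  proof (cases "I \<in> index_sets n")
    case True
    then have I: "I \<subseteq> {1..n}" by (simp add: index_sets_def)
    define J where "J = {u \<in> {1..m}. \<sigma> u \<in> I}"
    have img: "(\<lambda>W. {u \<in> {1..M}. \<rho> u \<in> W}) ` {W. W \<subseteq> {1..N - 1} \<and> W \<inter> {1..n} = I}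
        = {W. W \<subseteq> {1..M - 1} \<and> W \<inter> {1..m} = J}" (is "?f ` ?A = ?B")
    proof (intro equalityI subsetI)
      fix W' assume "W' \<in> ?f ` ?A"
      then obtain W where W: "W \<subseteq> {1..N - 1}" "W \<inter> {1..n} = I" and W': "W' = ?f W" by blast
      have "N \<notin> W" using W(1) N by auto
      have "\<rho> M = N" using M by (simp add: \<rho>_def N_def)
      then have MW': "M \<notin> W'" using \<open>N \<notin> W\<close> W' by simp
      have "u \<in> {1..M - 1}" if "u \<in> W'" for u
      proof -
        have "1 \<le> u" "u \<le> M" using W' that by auto
        moreover have "u \<noteq> M" using MW' that by blast
        ultimately show ?thesis by simp
      qed
      then have "W' \<subseteq> {1..M - 1}" by blast
      moreover have "\<rho> u \<in> W \<longleftrightarrow> \<sigma> u \<in> I" if "1 \<le> u" "u \<le> m" for u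
        using that \<open>N \<notin> W\<close> W(2) I \<sigma>_le[of u] by (auto simp: \<rho>_def)
      then have "W' \<inter> {1..m} = J" using W' M by (auto simp: J_def)
      ultimately show "W' \<in> ?B" by simp
    next
      fix W' assume W': "W' \<in> ?B"
      \<comment> \<open>All of \<open>I\<close> is put in, including terminals to which nothing is
        sent, as \<open>W \<inter> {1..n} = I\<close> demands.\<close>
      define W where "W = I \<union> (\<lambda>u. u - m + n) ` (W' - {1..m})"
      have "W \<subseteq> {1..N - 1}" using W' I M N by (force simp: W_def N_def)
      moreover have "W \<inter> {1..n} = I" using W' I by (auto simp: W_def)
      moreover have "?f W = W'"
      proof (intro equalityI subsetI)
        fix u assume "u \<in> ?f W"
        then have u: "1 \<le> u" "u \<le> M" "\<rho> u \<in> W" by auto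
        show "u \<in> W'"
        proof (cases "u \<le> m")
          case True
          have "N \<notin> W" using \<open>W \<subseteq> {1..N - 1}\<close> N by auto
          then have "\<sigma> u \<in> W" using u True by (auto simp: \<rho>_def split: if_splits)
          moreover have "\<sigma> u \<noteq> 0" using u True \<open>N \<notin> W\<close> by (auto simp: \<rho>_def split: if_splits)
          ultimately have "\<sigma> u \<in> I" using \<sigma>_le[of u] u True \<open>W \<inter> {1..n} = I\<close> by auto
          then show ?thesis using W' u True by (auto simp: J_def)
        next
          case False
          then have "u - m + n \<in> W" using u by (simp add: \<rho>_def)
          moreover have "u - m + n \<notin> I" using subsetD[OF I, of "u - m + n"] False by auto
          ultimately obtain v where v: "v \<in> W'" "v \<notin> {1..m}" "u - m + n = v - m + n"
            by (auto simp: W_def)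
          have "v \<ge> 1" using W' v by auto
          then have "u = v" using v False by auto
          then show ?thesis using v by simp
        qed
      next
        fix u assume u: "u \<in> W'"
        then have "u \<in> {1..M - 1}" using W' by blast
        then have "1 \<le> u" "u \<le> M" by auto
        moreover have "\<rho> u \<in> W"
        proof (cases "u \<le> m")
          case True
          then have "\<sigma> u \<in> I" using W' u \<open>1 \<le> u\<close> by (auto simp: J_def)
          then show ?thesis using I True by (auto simp: \<rho>_def W_def)
        next
          case False
          then have "u - m + n \<in> W" unfolding W_def using u by (intro UnI2 imageI) simp
          then show ?thesis using False by (simp add: \<rho>_def)
        qed
        ultimately show "u \<in> ?f W" by simp
      qed
      ultimately show "W' \<in> ?f ` ?A" by blast
    qed
    have "network_vec n N (push_weights M \<rho> w) I = Min (cut_weight M w ` ?f ` ?A)"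
      using True by (simp add: network_vec_def cut_weight_push[OF \<rho>] image_image)
    also have "\<dots> = Min (cut_weight M w ` ?B)" by (simp only: img)
    also have "\<dots> = S J"
    proof (cases "J = {}")
      case False
      then have "J \<in> index_sets m" by (auto simp: index_sets_def J_def)
      then show ?thesis by (simp add: S_eq network_vec_def)
    next
      case True
      \<comment> \<open>The default value \<open>S {} = 0\<close> is the true minimum here: the
        empty side is admissible and has weight 0.\<close>
      have "Min (cut_weight M w ` ?B) = 0"
      proof (rule Min_eqI)
        have "?B \<subseteq> Pow {1..M - 1}" by auto
        then have "finite ?B" by (rule finite_subset) simp
        then show "finite (cut_weight M w ` ?B)" by simp
        show "y \<ge> 0" if "y \<in> cut_weight M w ` ?B" for y
          using that cut_weight_nonneg[OF w] by auto
        have "cut_weight M w {} = 0" by (simp add: cut_weight_def cut_def)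
        moreover have "{} \<in> ?B" using True by auto
        ultimately show "0 \<in> cut_weight M w ` ?B" by (metis imageI)
      qed
      then show ?thesis using True by (simp add: S_eq network_vec_def index_sets_def)
    qed
    finally show ?thesis using True by (simp add: pull_vec_def J_def)
  qed (simp add: network_vec_def pull_vec_def)
  then have "pull_vec m n \<sigma> S = network_vec n N (push_weights M \<rho> w)" by (intro ext) simp
  then show ?thesis using N weight_map_push[OF w] by (auto simp: H_iff)
qed

section \<open>Minimum cuts of stars\<close>

definition star_vec :: "nat \<Rightarrow> (nat \<Rightarrow> real) \<Rightarrow> nat set \<Rightarrow> real"
  where "star_vec n x = (\<lambda>I. if I \<in> index_sets n then min (sum x I) (sum x ({0..n} - I)) else 0)"

text \<open>Join a centre to every terminal \<open>u\<close> with weight \<open>x u\<close> and to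
  the sink with weight \<open>x 0\<close>. The only choice left to a cut is the side of the centre:
  on the sink side it pays for the leaves in \<open>I\<close>, on the other side for the leaves
  outside.\<close>

lemma star_vec_in_H:
  assumes x: "\<And>u. u \<le> n \<Longrightarrow> x u \<ge> 0"
  shows "star_vec n x \<in> H n"
proof -
  \<comment> \<open>Vertex \<open>n + 1\<close> is the centre and \<open>n + 2\<close> the sink;
    \<open>lab\<close> translates the label 0 into the latter.\<close>
  define N where "N = n + 2"
  define lab where "lab u = (if u = 0 then N else u)" for u
  define w where "w e = (\<Sum>u\<in>{0..n}. if e = {lab u, n + 1} then x u else 0)" for e
  have w: "weight_map N w"
    using x by (auto simp: weight_map_def w_def intro!: sum_nonneg)
  have cw: "cut_weight N w W = (\<Sum>u\<in>{0..n}. if separates W (lab u) (n + 1) then x u else 0)" for W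
  proof -
    have "cut_weight N w W = (\<Sum>u\<in>{0..n}. \<Sum>e\<in>cut N W. if e = {lab u, n + 1} then x u else 0)"
      unfolding cut_weight_def w_def by (rule sum.swap)
    also have "\<dots> = (\<Sum>u\<in>{0..n}. if {lab u, n + 1} \<in> cut N W then x u else 0)"
      by (simp add: sum.delta)
    also have "\<dots> = (\<Sum>u\<in>{0..n}. if separates W (lab u) (n + 1) then x u else 0)"
      by (intro sum.cong) (auto simp: edge_mem_cut_iff lab_def N_def)
    finally show ?thesis .
  qed
  have "star_vec n x I = network_vec n N w I" for I
  proof (cases "I \<in> index_sets n")
    case True
    then have I: "I \<subseteq> {1..n}" by (simp add: index_sets_def)
    have "{W. W \<subseteq> {1..N - 1} \<and> W \<inter> {1..n} = I} = {I, insert (n + 1) I}"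
    proof (intro equalityI subsetI)
      fix W assume "W \<in> {W. W \<subseteq> {1..N - 1} \<and> W \<inter> {1..n} = I}"
      then have W: "W \<subseteq> {1..n + 1}" "W \<inter> {1..n} = I" by (auto simp: N_def)
      have "{1..n + 1} = insert (n + 1) {1..n}" by auto
      then show "W \<in> {I, insert (n + 1) I}" using W by auto
    qed (use I in \<open>auto simp: N_def\<close>)
    moreover have "cut_weight N w I = sum x I"
    proof -
      have "separates I (lab u) (n + 1) \<longleftrightarrow> u \<in> I" if "u \<le> n" for u
        using I that by (auto simp: separates_def lab_def N_def)
      then have "cut_weight N w I = (\<Sum>u\<in>{0..n}. if u \<in> I then x u else 0)"
        unfolding cw by (intro sum.cong) auto
      also have "\<dots> = sum x ({0..n} \<inter> I)" by (simp add: sum.inter_restrict)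
      also have "{0..n} \<inter> I = I" using I by auto
      finally show ?thesis .
    qed
    moreover have "cut_weight N w (insert (n + 1) I) = sum x ({0..n} - I)"
    proof -
      have "separates (insert (n + 1) I) (lab u) (n + 1) \<longleftrightarrow> u \<in> - I" if "u \<le> n" for u
        using I that by (auto simp: separates_def lab_def N_def)
      then have "cut_weight N w (insert (n + 1) I) = (\<Sum>u\<in>{0..n}. if u \<in> - I then x u else 0)"
        unfolding cw by (intro sum.cong) auto
      also have "\<dots> = sum x ({0..n} \<inter> - I)" by (rule sum.inter_restrict[symmetric]) simp
      finally show ?thesis by (simp add: Diff_eq)
    qed
    ultimately show ?thesis using True by (simp add: star_vec_def network_vec_def)
  qed (simp add: star_vec_def network_vec_def)
  then have "star_vec n x = network_vec n N w" by (intro ext)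
  moreover have "N > n" by (simp add: N_def)
  ultimately show ?thesis using w unfolding H_iff by blast
qed

section \<open>Stars with two dominant terminals\<close>

definition edge_vec :: "nat \<Rightarrow> nat \<Rightarrow> nat \<Rightarrow> nat set \<Rightarrow> real"
  where "edge_vec n u v = (\<lambda>I. if I \<in> index_sets n \<and> separates I u v then 1 else 0)"

text \<open>An edge is the star with weight 1 at its two ends: the lighter side has weight 1 if the
  ends are separated and 0 otherwise.\<close>

lemma edge_vec_in_H:
  assumes "u \<le> n" "v \<le> n" "u \<noteq> v"
  shows "edge_vec n u v \<in> H n"
proof -
  define x :: "nat \<Rightarrow> real" where "x t = (if t = u then 1 else 0) + (if t = v then 1 else 0)" for t
  have sum_x: "sum x A = (if u \<in> A then 1 else 0) + (if v \<in> A then 1 else 0)" if "finite A" for A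
    using that by (simp add: x_def sum.distrib)
  have "edge_vec n u v I = star_vec n x I" for I
  proof (cases "I \<in> index_sets n")
    case True
    then have "finite I" by (auto simp: index_sets_def intro: finite_subset)
    then show ?thesis
      using True assms by (auto simp: edge_vec_def star_vec_def sum_x separates_def)
  qed (simp add: edge_vec_def star_vec_def)
  then have "edge_vec n u v = star_vec n x" by (intro ext)
  moreover have "star_vec n x \<in> H n" by (rule star_vec_in_H) (simp add: x_def)
  ultimately show ?thesis by simp
qed

text \<open>
  A superbalanced inequality supported on sets not separating \<open>a\<close> from \<open>z\<close> is tight at
  all of these vectors. As elsewhere below, the label 0 stands for the sink.
\<close>

definition flat_vecs :: "nat \<Rightarrow> nat \<Rightarrow> nat \<Rightarrow> (nat set \<Rightarrow> real) set"
  where "flat_vecs n a z = {S \<in> H n. \<exists>c. \<forall>I\<in>index_sets n. \<not> separates I a z \<longrightarrow>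
    S I = (\<Sum>u\<in>{0..n} - {a, z}. c u * (if separates I a u then 1 else 0))}"

text \<open>The coefficients are the indicator of \<open>u\<close>. For \<open>u = z\<close> this
  index is missing from the sum, and rightly so: the edge is then not cut by the sets in
  question.\<close>

lemma edge_vec_in_flat_vecs:
  assumes "a \<le> n" "u \<le> n" "u \<noteq> a"
  shows "edge_vec n a u \<in> flat_vecs n a z"
proof -
  have "edge_vec n a u I
      = (\<Sum>v\<in>{0..n} - {a, z}. (if v = u then 1 else 0) * (if separates I a v then 1 else 0))"
    if I: "I \<in> index_sets n" "\<not> separates I a z" for I
  proof -
    have "(\<Sum>v\<in>{0..n} - {a, z}. (if v = u then 1 else 0) * (if separates I a v then 1 else 0))
        = (\<Sum>v\<in>{0..n} - {a, z}. if v = u then if separates I a u then 1 else 0 else (0::real))"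
      by (rule sum.cong) auto
    also have "\<dots> = edge_vec n a u I"
      using I assms by (auto simp: edge_vec_def)
    finally show ?thesis by simp
  qed
  then show ?thesis
    using edge_vec_in_H[of a n u] assms unfolding flat_vecs_def
    by (intro CollectI conjI exI[of _ "\<lambda>v. if v = u then 1 else 0"]) simp_all
qed

text \<open>
  The star with weights 1 at \<open>K\<close>, \<open>1/2\<close> at \<open>z\<close> and \<open>card K - 1/2\<close> at \<open>a\<close>: the centre
  is always on the side of \<open>a\<close>, unless all of \<open>K\<close> and \<open>z\<close> are separated from \<open>a\<close>.
\<close>

lemma flat_star:
  fixes n a z :: nat and K :: "nat set"
  assumes az: "a \<le> n" "z \<le> n" "a \<noteq> z" and K: "K \<subseteq> {0..n} - {a, z}" "K \<noteq> {}"
  obtains S where "S \<in> flat_vecs n a z"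
    and "\<And>I. I \<in> index_sets n \<Longrightarrow> S I = (\<Sum>u\<in>K. if separates I a u then 1 else 0)
      + (if separates I a z then 1 / 2 - (if \<forall>u\<in>K. separates I a u then 1 else 0) else 0)"
proof
  define x :: "nat \<Rightarrow> real" where "x t = (if t \<in> K then 1 else 0) + (if t = z then 1 / 2 else 0)
    + (if t = a then real (card K) - 1 / 2 else 0)" for t
  have finK: "finite K" using K by (auto intro: finite_subset)
  then have "card K > 0" using K(2) by (simp add: card_gt_0_iff)
  then have cK: "real (card K) \<ge> 1" by linarith
  have sum_x: "sum x A = card (A \<inter> K) + (if z \<in> A then 1 / 2 else 0)
      + (if a \<in> A then card K - 1 / 2 else 0)" if "finite A" for A
    using that by (simp add: x_def sum.distrib sum.If_cases)
  define d where "d I = card {u \<in> K. separates I a u}" for I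
  have d_eq: "real (d I) = (\<Sum>u\<in>K. if separates I a u then 1 else 0)" for I
    using finK by (simp add: d_def sum.If_cases Int_def)
  have d_le: "d I \<le> card K" for I
    unfolding d_def by (rule card_mono[OF finK]) auto
  have d_max: "d I = card K \<longleftrightarrow> (\<forall>u\<in>K. separates I a u)" for I
  proof
    assume "d I = card K"
    have "{u \<in> K. separates I a u} \<subseteq> K" by blast
    from card_subset_eq[OF finK this] \<open>d I = card K\<close> have "{u \<in> K. separates I a u} = K"
      by (simp add: d_def)
    then show "\<forall>u\<in>K. separates I a u" by blast
  next
    assume "\<forall>u\<in>K. separates I a u"
    then have "{u \<in> K. separates I a u} = K" by blast
    then show "d I = card K" by (simp add: d_def)
  qed
  have star: "star_vec n x I = (if separates I a z
      then d I + 1 / 2 - (if d I = card K then 1 else 0) else d I)"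
    if I: "I \<in> index_sets n" for I
  proof -
    have fin: "finite I" using I by (auto simp: index_sets_def intro: finite_subset)
    have split_K: "real (card K) = card (I \<inter> K) + card (({0..n} - I) \<inter> K)"
    proof -
      have "(I \<inter> K) \<union> (({0..n} - I) \<inter> K) = K" using K by auto
      moreover have "card ((I \<inter> K) \<union> (({0..n} - I) \<inter> K)) = card (I \<inter> K) + card (({0..n} - I) \<inter> K)"
        by (rule card_Un_disjoint) (use finK in auto)
      ultimately have "card K = card (I \<inter> K) + card (({0..n} - I) \<inter> K)" by (simp only:)
      then show ?thesis by linarith
    qed
    have d_side: "d I = (if a \<in> I then card (({0..n} - I) \<inter> K) else card (I \<inter> K))"
    proof -
      have "{u \<in> K. separates I a u} = (if a \<in> I then ({0..n} - I) \<inter> K else I \<inter> K)"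
        using K by (auto simp: separates_def)
      then show ?thesis by (simp add: d_def)
    qed
    \<comment> \<open>Integrality enters here: for \<open>a\<close> and \<open>z\<close> separated,
      the minimum changes sides when \<open>d I\<close> exceeds \<open>card K - 1 / 2\<close>, so
      only at \<open>d I = card K\<close>.\<close>
    have d_cases: "d I = card K \<or> real (d I) + 1 \<le> card K" using d_le[of I] by linarith
    \<comment> \<open>Here \<open>p\<close> and \<open>p'\<close> count \<open>K\<close> inside and
      outside \<open>I\<close>, and \<open>e\<close> counts \<open>K\<close> on the side away from
      \<open>a\<close>. The total weight is \<open>2 * k\<close>, so without \<open>z\<close> the
      far side never outweighs the side of \<open>a\<close>; with \<open>z\<close> it weighs
      \<open>e + 1 / 2\<close> against \<open>2 * k - e - 1 / 2\<close>.\<close>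
    have arith: "min s t = (if separates I a z then e + 1 / 2 - (if e = k then 1 else 0) else e)"
      if s: "s = p + (if z \<in> I then 1 / 2 else 0) + (if a \<in> I then k - 1 / 2 else 0)"
        and t: "t = p' + (if z \<in> I then 0 else 1 / 2) + (if a \<in> I then 0 else k - 1 / 2)"
        and k: "k = p + p'" "k \<ge> 1" and e: "e = (if a \<in> I then p' else p)" "e = k \<or> e + 1 \<le> k"
        and pos: "p \<ge> 0" "p' \<ge> 0"
      for s t k p p' e :: real
    proof (cases "a \<in> I")
      case True
      then show ?thesis
        using s t k e pos by (cases "z \<in> I") (simp_all add: separates_def min_def, linarith+)
    next
      case False
      then show ?thesis
        using s t k e pos by (cases "z \<in> I") (simp_all add: separates_def min_def, linarith+)
    qed
    have "star_vec n x I = min (sum x I) (sum x ({0..n} - I))"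
      using I by (simp add: star_vec_def)
    moreover have "min (sum x I) (sum x ({0..n} - I)) = (if separates I a z
      then real (d I) + 1 / 2 - (if real (d I) = real (card K) then 1 else 0) else real (d I))"
    proof (rule arith)
      show "sum x I = real (card (I \<inter> K)) + (if z \<in> I then 1 / 2 else 0)
          + (if a \<in> I then real (card K) - 1 / 2 else 0)"
        by (rule sum_x[OF fin])
      show "sum x ({0..n} - I) = real (card (({0..n} - I) \<inter> K)) + (if z \<in> I then 0 else 1 / 2)
          + (if a \<in> I then 0 else real (card K) - 1 / 2)"
        using sum_x[of "{0..n} - I"] az by simp
      show "real (d I) = (if a \<in> I then real (card (({0..n} - I) \<inter> K)) else real (card (I \<inter> K)))"
        unfolding d_side by simp
      show "real (d I) = real (card K) \<or> real (d I) + 1 \<le> real (card K)"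
        using d_cases by linarith
    qed (use split_K cK in simp_all)
    ultimately show ?thesis by (simp only: of_nat_eq_iff)
  qed
  then show "star_vec n x I = (\<Sum>u\<in>K. if separates I a u then 1 else 0)
      + (if separates I a z then 1 / 2 - (if \<forall>u\<in>K. separates I a u then 1 else 0) else 0)"
    if "I \<in> index_sets n" for I
    using that d_max by (simp add: d_eq)
  have "star_vec n x \<in> H n"
    by (rule star_vec_in_H) (use cK in \<open>simp add: x_def\<close>)
  moreover have "star_vec n x I
      = (\<Sum>u\<in>{0..n} - {a, z}. (if u \<in> K then 1 else 0) * (if separates I a u then 1 else 0))"
    if "I \<in> index_sets n" "\<not> separates I a z" for I
  proof -
    have "(\<Sum>u\<in>{0..n} - {a, z}. (if u \<in> K then 1 else 0) * (if separates I a u then 1 else 0))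
        = (\<Sum>u\<in>K. if separates I a u then 1 else (0::real))"
      by (rule sum.mono_neutral_cong_right) (use K in auto)
    then show ?thesis using star[OF that(1)] that(2) by (simp add: d_eq)
  qed
  ultimately show "star_vec n x \<in> flat_vecs n a z"
    unfolding flat_vecs_def
    by (intro CollectI conjI exI[of _ "\<lambda>u. if u \<in> K then 1 else 0"]) simp_all
qed

lemma up_set_vec_in_span_flat_vecs:
  assumes az: "a \<le> n" "z \<le> n" "a \<noteq> z" and K: "K \<subseteq> {0..n} - {a, z}"
  shows "(\<lambda>I. if I \<in> index_sets n \<and> separates I a z \<and> (\<forall>u\<in>K. separates I a u) then 1 else 0)
    \<in> span (flat_vecs n a z)" (is "?h \<in> _")
proof (cases "K = {}")
  case True
  then have "?h = edge_vec n a z" by (auto simp: edge_vec_def)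
  then show ?thesis using edge_vec_in_flat_vecs[of a n z z] az by (simp add: span_base)
next
  case False
  obtain S where S: "S \<in> flat_vecs n a z"
    and S_eq: "\<And>I. I \<in> index_sets n \<Longrightarrow> S I = (\<Sum>u\<in>K. if separates I a u then 1 else 0)
      + (if separates I a z then 1 / 2 - (if \<forall>u\<in>K. separates I a u then 1 else 0) else 0)"
    using flat_star[OF az K False] by blast
  have S_0: "S I = 0" if "I \<notin> index_sets n" for I
    using S H_subset_cut_space[of n] that by (auto simp: flat_vecs_def cut_space_def)
  have "?h = (\<Sum>u\<in>K. edge_vec n a u) + (1 / 2) *\<^sub>R edge_vec n a z - S"
  proof
    fix I
    have "(\<Sum>u\<in>K. edge_vec n a u) I
        = (\<Sum>u\<in>K. if I \<in> index_sets n \<and> separates I a u then 1 else 0)"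
      unfolding sum_fun_apply by (simp add: edge_vec_def)
    then show "?h I = ((\<Sum>u\<in>K. edge_vec n a u) + (1 / 2) *\<^sub>R edge_vec n a z - S) I"
      by (cases "I \<in> index_sets n") (simp_all add: S_eq S_0 edge_vec_def)
  qed
  also have "\<dots> \<in> span (flat_vecs n a z)"
  proof (intro span_add span_diff span_sum span_scale)
    show "S \<in> span (flat_vecs n a z)" using S by (rule span_base)
    show "edge_vec n a z \<in> span (flat_vecs n a z)"
      using az by (intro span_base edge_vec_in_flat_vecs) auto
    show "edge_vec n a u \<in> span (flat_vecs n a z)" if "u \<in> K" for u
      using az K that by (intro span_base edge_vec_in_flat_vecs) auto
  qed
  finally show ?thesis .
qed

text \<open>Moebius inversion: a set separating \<open>a\<close> from \<open>z\<close> is determined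
  by \<open>far\<close>, the remaining labels on the side away from \<open>a\<close>. The indicator
  from \<open>up_set_vec_in_span_flat_vecs\<close> is the sum of the unit vectors of all sets whose
  \<open>far\<close> is at least as large, so the unit vectors are obtained by induction from the
  largest \<open>far\<close> down.\<close>

lemma unit_vec_in_span_flat_vecs:
  assumes az: "a \<le> n" "z \<le> n" "a \<noteq> z" and J: "J \<in> index_sets n" "separates J a z"
  shows "unit_vec J \<in> span (flat_vecs n a z)"
proof -
  define R where "R = {0..n} - {a, z}"
  define far where "far I = {u \<in> R. separates I a u}" for I
  have finR: "finite R" by (simp add: R_def)
  have far_inj: "I = J" if I: "I \<in> index_sets n" "separates I a z"
    and J: "J \<in> index_sets n" "separates J a z" and eq: "far I = far J" for I J
  proof -
    have sep: "separates I a u \<longleftrightarrow> separates J a u" if "u \<le> n" for u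
    proof (cases "u \<in> R")
      case True
      then show ?thesis using eq by (auto simp: far_def)
    next
      case False
      then have "u = a \<or> u = z" using that by (auto simp: R_def)
      then show ?thesis using I(2) J(2) by (auto simp: separates_def)
    qed
    \<comment> \<open>The separated pairs fix a set only up to complement; the sink label 0
      decides.\<close>
    have "0 \<notin> I" "0 \<notin> J" using I(1) J(1) by (auto simp: index_sets_def)
    then have a: "a \<in> I \<longleftrightarrow> a \<in> J" using sep[of 0] by (auto simp: separates_def)
    have "u \<in> I \<longleftrightarrow> u \<in> J" if "u \<le> n" for u
      using sep[OF that] a by (auto simp: separates_def)
    moreover have "u \<le> n" if "u \<in> I \<or> u \<in> J" for u
      using that I(1) J(1) by (auto simp: index_sets_def)
    ultimately show ?thesis by blast
  qed
  show ?thesis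
    using J
  proof (induction "card (R - far J)" arbitrary: J rule: less_induct)
    case less
    define U where "U = {I \<in> index_sets n. separates I a z \<and> far J \<subseteq> far I}"
    let ?h = "\<lambda>I. if I \<in> index_sets n \<and> separates I a z \<and> (\<forall>u\<in>far J. separates I a u)
      then 1 else (0::real)"
    have finU: "finite U" by (simp add: U_def)
    have "?h I = (\<Sum>I'\<in>U. unit_vec I') I" for I
    proof -
      have "?h I = (if I \<in> U then 1 else 0)" by (auto simp: U_def far_def)
      also have "\<dots> = (\<Sum>I'\<in>U. unit_vec I') I"
        using finU by (simp add: sum_fun_apply unit_vec_def)
      finally show ?thesis .
    qed
    then have "?h = (\<Sum>I'\<in>U. unit_vec I')" by (intro ext)
    also have "\<dots> = unit_vec J + (\<Sum>I'\<in>U - {J}. unit_vec I')"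
      using finU less.prems by (intro sum.remove) (auto simp: U_def)
    finally have eq: "unit_vec J = ?h - (\<Sum>I'\<in>U - {J}. unit_vec I')" by simp
    have "?h \<in> span (flat_vecs n a z)"
      by (rule up_set_vec_in_span_flat_vecs[OF az]) (auto simp: far_def R_def)
    moreover have "unit_vec I' \<in> span (flat_vecs n a z)" if "I' \<in> U - {J}" for I'
    proof (rule less.hyps)
      show I': "I' \<in> index_sets n" "separates I' a z" using that by (auto simp: U_def)
      then have "far I' \<noteq> far J" using far_inj[OF I' less.prems] that by blast
      then have "R - far I' \<subset> R - far J"
        using that by (auto simp: U_def far_def)
      then show "card (R - far I') < card (R - far J)"
        using finR by (intro psubset_card_mono) auto
    qed
    ultimately show ?case
      unfolding eq by (intro span_diff span_sum)
  qed
qed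


section \<open>Superbalanced inequalities\<close>

lemma image_permutes_mem_iff: "\<pi> permutes A \<Longrightarrow> x \<in> \<pi> ` I \<longleftrightarrow> inv \<pi> x \<in> I"
  using permutes_inverses by (metis image_iff)

text \<open>After complementing, the coordinate of the permuted set contains \<open>j\<close>
  exactly if that set separates \<open>j\<close> from the sink \<open>N\<close>; undoing the
  permutation gives the condition on \<open>I\<close>.\<close>

lemma sum_permute_ineq:
  assumes N: "N > n" and \<pi>: "\<pi> permutes insert N {1..n}" and j: "j \<in> {1..n}"
  shows "(\<Sum>J | J \<in> index_sets n \<and> j \<in> J. permute_ineq n N \<pi> q J)
    = (\<Sum>I\<in>index_sets n. if separates I (inv \<pi> j) (inv \<pi> N) then q I else 0)"
proof -
  let ?c = "\<lambda>I. coord_index n N (\<pi> ` I)"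
  let ?A = "{J \<in> index_sets n. j \<in> J}"
  let ?S = "{I \<in> index_sets n. separates I (inv \<pi> j) (inv \<pi> N)}"
  have mem: "?c I \<in> ?A \<longleftrightarrow> separates I (inv \<pi> j) (inv \<pi> N)" if I: "I \<in> index_sets n" for I
  proof -
    have "\<pi> ` I \<subseteq> \<pi> ` insert N {1..n}" using I by (auto simp: index_sets_def)
    then have sub: "\<pi> ` I \<subseteq> insert N {1..n}" using permutes_image[OF \<pi>] by simp
    have "j \<noteq> N" using j N by auto
    then have "j \<in> ?c I \<longleftrightarrow> separates I (inv \<pi> j) (inv \<pi> N)"
      using j image_permutes_mem_iff[OF \<pi>, of j I] image_permutes_mem_iff[OF \<pi>, of N I]
      by (auto simp: coord_index_def separates_def)
    moreover have "?c I \<subseteq> {1..n}" using sub by (auto simp: coord_index_def)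
    ultimately show ?thesis by (auto simp: index_sets_def)
  qed
  have "sum (permute_ineq n N \<pi> q) ?A = (\<Sum>J\<in>?A. sum q {I \<in> ?S. ?c I = J})"
    unfolding permute_ineq_def using mem by (intro sum.cong refl arg_cong[of _ _ "sum q"]) auto
  also have "\<dots> = sum q ?S"
    by (rule sum.group) (use mem in auto)
  also have "\<dots> = (\<Sum>I\<in>index_sets n. if separates I (inv \<pi> j) (inv \<pi> N) then q I else 0)"
    by (rule sum.inter_filter) simp
  finally show ?thesis by simp
qed

text \<open>A permutation matters only through the two labels it sends to \<open>j\<close> and to
  the sink, and transpositions with the sink already reach every pair containing a terminal.
  Balancedness itself is the case \<open>z = 0\<close>.\<close>

lemma superbalanced_iff:
  "superbalanced n q \<longleftrightarrow>
    (\<forall>a\<le>n. \<forall>z\<le>n. (\<Sum>I\<in>index_sets n. if separates I a z then q I else 0) = 0)"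
proof
  assume *: "superbalanced n q"
  have one: "(\<Sum>I\<in>index_sets n. if separates I a z then q I else 0) = 0"
    if az: "a \<le> n" "z \<le> n" "a \<noteq> z" "a \<noteq> 0" for a z
  proof -
    define N where "N = n + 1"
    define y where "y = (if z = 0 then N else z)"
    \<comment> \<open>The transposition fixes \<open>a\<close> and brings \<open>y\<close> to the
      place of the sink; for \<open>z = 0\<close> it is the identity.\<close>
    define \<pi> where "\<pi> = Transposition.transpose y N"
    have \<pi>: "\<pi> permutes insert N {1..n}"
      unfolding \<pi>_def by (rule permutes_swap_id) (use az in \<open>auto simp: y_def\<close>)
    have inv: "inv \<pi> a = a" "inv \<pi> N = y"
      using az by (auto simp: \<pi>_def y_def N_def Transposition.transpose_def)
    have a: "a \<in> {1..n}" using az by auto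
    have "N > n" by (simp add: N_def)
    then have "balanced n (permute_ineq n N \<pi> q)" using * \<pi> by (auto simp: superbalanced_def)
    then have "(\<Sum>I\<in>index_sets n. if separates I a y then q I else 0) = 0"
      using sum_permute_ineq[OF \<open>N > n\<close> \<pi> a, of q] a by (simp add: balanced_def inv)
    moreover have "separates I a y \<longleftrightarrow> separates I a z" if "I \<in> index_sets n" for I
      using that by (auto simp: separates_def y_def N_def index_sets_def)
    ultimately show ?thesis by simp
  qed
  have sym: "separates I a z \<longleftrightarrow> separates I z a" for I a z by (auto simp: separates_def)
  show "\<forall>a\<le>n. \<forall>z\<le>n. (\<Sum>I\<in>index_sets n. if separates I a z then q I else 0) = 0"
  proof (intro allI impI)
    fix a z assume "a \<le> n" "z \<le> n"
    show "(\<Sum>I\<in>index_sets n. if separates I a z then q I else 0) = 0"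
    proof (cases "a = z")
      case True
      then show ?thesis by (simp add: separates_def)
    next
      case False
      then consider "a \<noteq> 0" | "z \<noteq> 0" by auto
      then show ?thesis
      proof cases
        case 1
        then show ?thesis using one \<open>a \<le> n\<close> \<open>z \<le> n\<close> False by blast
      next
        case 2
        then show ?thesis using one[of z a] \<open>a \<le> n\<close> \<open>z \<le> n\<close> False by (simp add: sym[of _ a z])
      qed
    qed
  qed
next
  assume *: "\<forall>a\<le>n. \<forall>z\<le>n. (\<Sum>I\<in>index_sets n. if separates I a z then q I else 0) = 0"
  show "superbalanced n q"
    unfolding superbalanced_def
  proof (intro conjI allI impI)
    show "balanced n q"
      unfolding balanced_def
    proof
      fix j assume j: "j \<in> {1..n}"
      have "(\<Sum>I | I \<in> index_sets n \<and> j \<in> I. q I) = (\<Sum>I\<in>index_sets n. if j \<in> I then q I else 0)"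
        by (rule sum.inter_filter) simp
      also have "\<dots> = (\<Sum>I\<in>index_sets n. if separates I j 0 then q I else 0)"
        by (intro sum.cong) (auto simp: separates_def index_sets_def)
      finally show "(\<Sum>I | I \<in> index_sets n \<and> j \<in> I. q I) = 0" using * j by simp
    qed
    fix N \<pi> assume N: "n < N" and \<pi>: "\<pi> permutes insert N {1..n}"
    show "balanced n (permute_ineq n N \<pi> q)"
      unfolding balanced_def
    proof
      fix j assume j: "j \<in> {1..n}"
      define lab where "lab u = (if u = N then 0 else u)" for u
      have "inv \<pi> v \<in> insert N {1..n}" if "v \<in> insert N {1..n}" for v
        using permutes_in_image[OF permutes_inv[OF \<pi>]] that by blast
      then have le: "lab (inv \<pi> v) \<le> n" if "v \<in> insert N {1..n}" for v
        using that by (fastforce simp: lab_def)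
      have "separates I (inv \<pi> j) (inv \<pi> N) \<longleftrightarrow> separates I (lab (inv \<pi> j)) (lab (inv \<pi> N))"
        if "I \<in> index_sets n" for I
        using that N by (auto simp: separates_def lab_def index_sets_def)
      then have "(\<Sum>I\<in>index_sets n. if separates I (inv \<pi> j) (inv \<pi> N) then q I else 0)
          = (\<Sum>I\<in>index_sets n. if separates I (lab (inv \<pi> j)) (lab (inv \<pi> N)) then q I else 0)"
        by (intro sum.cong) simp_all
      also have "\<dots> = 0" using * le j by simp
      finally show "(\<Sum>J | J \<in> index_sets n \<and> j \<in> J. permute_ineq n N \<pi> q J) = 0"
        using sum_permute_ineq[OF N \<pi> j, of q] by simp
    qed
  qed
qed

text \<open>After exchanging the sums, each \<open>c u\<close> multiplies the vanishing edge sum of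
  \<open>v\<close> and \<open>f u\<close>. Agreement is asked only on the support of
  \<open>q\<close>, and \<open>f\<close> leaves room for endpoints moved by a contraction.\<close>

lemma ineq_lhs_flat_eq_0:
  assumes q: "superbalanced n q" and v: "v \<le> n"
    and S: "\<And>I. I \<in> index_sets n \<Longrightarrow> q I \<noteq> 0 \<Longrightarrow>
      S I = (\<Sum>u\<in>A. c u * (if separates I v (f u) then 1 else 0))"
    and f: "\<And>u. u \<in> A \<Longrightarrow> f u \<le> n"
  shows "ineq_lhs n q S = 0"
proof -
  have "q I * S I = (\<Sum>u\<in>A. c u * (if separates I v (f u) then q I else 0))"
    if "I \<in> index_sets n" for I
  proof (cases "q I = 0")
    case True
    then show ?thesis by (intro trans[OF _ sum.neutral[symmetric]]) auto
  next
    case False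
    then show ?thesis
      by (subst S[OF that False]) (auto simp: sum_distrib_left intro!: sum.cong)
  qed
  then have "ineq_lhs n q S
      = (\<Sum>I\<in>index_sets n. \<Sum>u\<in>A. c u * (if separates I v (f u) then q I else 0))"
    unfolding ineq_lhs_def by (intro sum.cong) auto
  also have "\<dots> = (\<Sum>u\<in>A. c u * (\<Sum>I\<in>index_sets n. if separates I v (f u) then q I else 0))"
    unfolding sum_distrib_left by (rule sum.swap)
  also have "\<dots> = 0"
    using q v f by (intro sum.neutral) (simp add: superbalanced_iff)
  finally show ?thesis .
qed


section \<open>Facets\<close>

lemma zero_in_H: "0 \<in> H n"
proof -
  have "star_vec n (\<lambda>_. 0) = 0" by (auto simp: star_vec_def)
  then show ?thesis using star_vec_in_H[of n "\<lambda>_. 0"] by simp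
qed

lemma affine_dim_face: "affine_dim {S \<in> H n. ineq_lhs n q S = 0} = dim {S \<in> H n. ineq_lhs n q S = 0}"
  by (rule affine_dim_eq_dim_of_zero_mem) (simp add: zero_in_H linear_0[OF linear_ineq_lhs])

text \<open>This is the full-dimensionality of the cone: a terminal \<open>z\<close> in
  \<open>J\<close> is separated by \<open>J\<close> from the sink 0, so the stars for that pair
  produce \<open>unit_vec J\<close>.\<close>

lemma span_H: "span (H n) = cut_space n"
proof (rule antisym)
  show "span (H n) \<subseteq> cut_space n"
    using H_subset_cut_space subspace_cut_space by (rule span_minimal)
  have "unit_vec J \<in> span (H n)" if J: "J \<in> index_sets n" for J
  proof -
    obtain z where z: "z \<in> J" using J by (auto simp: index_sets_def)
    then have "unit_vec J \<in> span (flat_vecs n 0 z)"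
      using J by (intro unit_vec_in_span_flat_vecs) (auto simp: index_sets_def separates_def)
    moreover have "span (flat_vecs n 0 z) \<subseteq> span (H n)"
      by (rule span_mono) (auto simp: flat_vecs_def)
    ultimately show ?thesis by blast
  qed
  then show "cut_space n \<subseteq> span (H n)"
    unfolding span_unit_vecs[symmetric] by (intro span_minimal) auto
qed

lemma dim_H: "dim (H n) = 2 ^ n - 1"
proof -
  have "dim (H n) = dim (unit_vec ` index_sets n)"
    by (rule span_eq_dim) (simp add: span_H span_unit_vecs)
  then show ?thesis
    using dim_eq_card_independent[OF independent_unit_vecs] by (simp add: card_unit_vecs)
qed

text \<open>For \<open>q = 0\<close> the face would be the whole cone, whose dimension is too large
  by one. This uses \<open>n \<ge> 1\<close>: for \<open>n = 0\<close> truncated subtraction makes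
  both dimensions 0.\<close>

lemma facet_nonzero:
  assumes "n \<ge> 1" "is_facet n q"
  obtains J where "J \<in> index_sets n" "q J \<noteq> 0"
proof (rule ccontr)
  assume "\<not> thesis"
  then have "ineq_lhs n q S = 0" for S
    unfolding ineq_lhs_def using that by (intro sum.neutral ballI) (metis mult_zero_left)
  then have "dim (H n) = 2 ^ n - 2"
    using assms(2) affine_dim_face[of n q] by (simp add: is_facet_def)
  moreover have "(2::nat) ^ n \<ge> 2 ^ 1" using assms(1) by (intro power_increasing) auto
  ultimately show False by (simp add: dim_H)
qed

text \<open>The facet condition as a spanning property: in this form it is used for \<open>q\<close>
  and established for the lift. The nonzero coefficient makes the hyperplane proper.\<close>

lemma affine_dim_face_eq_iff:
  assumes "J \<in> index_sets n" "q J \<noteq> 0"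
  shows "affine_dim {S \<in> H n. ineq_lhs n q S = 0} = 2 ^ n - 2 \<longleftrightarrow>
    (\<forall>x\<in>cut_space n. ineq_lhs n q x = 0 \<longrightarrow> x \<in> span {S \<in> H n. ineq_lhs n q S = 0})"
proof -
  have v: "unit_vec J \<in> span (unit_vec ` index_sets n)" "ineq_lhs n q (unit_vec J) \<noteq> 0"
    using assms by (auto simp: ineq_lhs_unit_vec intro: span_base)
  have "{S \<in> H n. ineq_lhs n q S = 0} \<subseteq> span (unit_vec ` index_sets n)"
    using H_subset_cut_space unfolding span_unit_vecs by blast
  then have "dim {S \<in> H n. ineq_lhs n q S = 0} = card (unit_vec ` index_sets n) - 1 \<longleftrightarrow>
    (\<forall>x\<in>span (unit_vec ` index_sets n). ineq_lhs n q x = 0 \<longrightarrow>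
      x \<in> span {S \<in> H n. ineq_lhs n q S = 0})"
    by (intro dim_eq_hyperplane_iff[where f = "ineq_lhs n q" and v = "unit_vec J"]
        independent_unit_vecs linear_ineq_lhs v) auto
  then show ?thesis
    by (simp add: affine_dim_face card_unit_vecs span_unit_vecs numeral_2_eq_2)
qed

theorem theorem5:
  fixes n :: nat and q :: "nat set \<Rightarrow> real" and B :: "nat \<Rightarrow> nat set"
  assumes "n \<ge> 1"
    and "superbalanced n q" and "is_facet n q"
    and "lift_family n q B"
  shows "superbalanced (n + 1) (zero_lift n q B) \<and> is_facet (n + 1) (zero_lift n q B)"
proof -
  define K where "K = terminals n q"
  define q' where "q' = zero_lift n q B"
  have B_ne: "B i \<noteq> {}" and B_sub: "B i \<subseteq> {1..n + 1}" if "i \<in> K" for i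
    using assms(4) that by (auto simp: lift_family_def K_def)
  have B_mem: "u \<in> {1..n + 1}" if "i \<in> K" "u \<in> B i" for i u
    using B_sub[OF that(1)] that(2) by (rule subsetD)
  have B_disj: "i = j" if "i \<in> K" "j \<in> K" "u \<in> B i" "u \<in> B j" for i j u
    using assms(4) that unfolding lift_family_def K_def disjoint_family_on_def by blast
  have K_sub: "K \<subseteq> {1..n}" by (auto simp: K_def terminals_def)
  have supp: "I \<subseteq> K" if "I \<in> index_sets n" "q I \<noteq> 0" for I
    using that by (auto simp: K_def terminals_def index_sets_def)

  \<comment> \<open>The contraction: a terminal of the lift goes to the index of its block, and
    everything outside the blocks to the sink 0.\<close>
  define \<sigma> where "\<sigma> u = (if \<exists>i\<in>K. u \<in> B i then THE i. i \<in> K \<and> u \<in> B i else 0)" for u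
  have \<sigma>_eq: "\<sigma> u = i" if "i \<in> K" "u \<in> B i" for u i
  proof -
    have "(THE i. i \<in> K \<and> u \<in> B i) = i" using that B_disj by (intro the_equality) auto
    then show ?thesis using that by (auto simp: \<sigma>_def)
  qed
  have \<sigma>_iff: "\<sigma> u = i \<longleftrightarrow> u \<in> B i" if "i \<in> K" for u i
  proof
    assume *: "\<sigma> u = i"
    show "u \<in> B i"
    proof (cases "\<exists>j\<in>K. u \<in> B j")
      case True
      then show ?thesis using \<sigma>_eq * by blast
    next
      case False
      then have "\<sigma> u = 0" unfolding \<sigma>_def by (rule if_not_P)
      then show ?thesis using * that K_sub by auto
    qed
  qed (use \<sigma>_eq that in blast)
  have \<sigma>_cases: "\<sigma> u = 0 \<or> \<sigma> u \<in> K" for u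
  proof (cases "\<exists>j\<in>K. u \<in> B j")
    case True
    then show ?thesis using \<sigma>_eq by blast
  next
    case False
    then have "\<sigma> u = 0" unfolding \<sigma>_def by (rule if_not_P)
    then show ?thesis ..
  qed
  have \<sigma>_le: "\<sigma> u \<le> n" for u using \<sigma>_cases[of u] K_sub by auto
  have \<sigma>_0: "\<sigma> 0 = 0"
  proof (rule ccontr)
    assume "\<sigma> 0 \<noteq> 0"
    then have "\<sigma> 0 \<in> K" using \<sigma>_cases[of 0] by simp
    then have "0 \<in> B (\<sigma> 0)" using \<sigma>_iff[of "\<sigma> 0" 0] by simp
    then show False using B_sub[OF \<open>\<sigma> 0 \<in> K\<close>] by auto
  qed
  \<comment> \<open>The union of the blocks indexed by \<open>I\<close>, written as a preimage so
    that it fits \<open>pull_vec\<close>. For \<open>i\<close> outside \<open>K\<close> the set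
    \<open>B i\<close> is arbitrary, hence the condition \<open>I \<subseteq> K\<close> in
    \<open>U_eq\<close>.\<close>
  define U where "U I = {u \<in> {1..n + 1}. \<sigma> u \<in> I}" for I
  have U_eq: "(\<Union>i\<in>I. B i) = U I" if "I \<subseteq> K" for I
  proof (intro equalityI subsetI)
    fix u assume "u \<in> (\<Union>i\<in>I. B i)"
    then obtain i where i: "i \<in> I" "u \<in> B i" by blast
    then have "i \<in> K" using that by blast
    then show "u \<in> U I" using i \<sigma>_eq[of i u] B_mem[of i u] by (simp add: U_def)
  next
    fix u assume u: "u \<in> U I"
    then have "\<sigma> u \<in> I" by (simp add: U_def)
    then have "u \<in> B (\<sigma> u)" using that \<sigma>_iff[of "\<sigma> u" u] by auto
    then show "u \<in> (\<Union>i\<in>I. B i)" using \<open>\<sigma> u \<in> I\<close> by blast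
  qed
  have sep_U: "separates (U I) a z \<longleftrightarrow> separates I (\<sigma> a) (\<sigma> z)"
    if "I \<in> index_sets n" "a \<le> n + 1" "z \<le> n + 1" for I a z
  proof -
    have "v \<in> U I \<longleftrightarrow> \<sigma> v \<in> I" if "v \<le> n + 1" for v
      using that \<open>I \<in> index_sets n\<close> \<sigma>_0 by (cases "v = 0") (auto simp: U_def index_sets_def)
    then show ?thesis using that by (simp add: separates_def)
  qed

  \<comment> \<open>A representative of each block; terminals that do not occur in \<open>q\<close>
    are merged into the sink.\<close>
  define \<tau> where "\<tau> i = (if i \<in> K then SOME u. u \<in> B i else 0)" for i
  have \<tau>_B: "\<tau> i \<in> B i" if "i \<in> K" for i
    using B_ne[OF that] that by (simp add: \<tau>_def some_in_eq)
  have U_\<tau>: "{i \<in> {1..n}. \<tau> i \<in> U I} = I" if "I \<subseteq> K" for I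
  proof (intro equalityI subsetI)
    fix i assume i: "i \<in> {i \<in> {1..n}. \<tau> i \<in> U I}"
    then have "i \<in> K" by (auto simp: \<tau>_def U_def split: if_splits)
    then have "\<sigma> (\<tau> i) = i" using \<sigma>_eq \<tau>_B by blast
    then show "i \<in> I" using i by (simp add: U_def)
  next
    fix i assume "i \<in> I"
    then have "i \<in> K" using that by blast
    then have "\<tau> i \<in> U I"
      using \<tau>_B[of i] B_mem[of i "\<tau> i"] \<sigma>_eq[of i "\<tau> i"] \<open>i \<in> I\<close> by (simp add: U_def)
    then show "i \<in> {i \<in> {1..n}. \<tau> i \<in> U I}" using \<open>i \<in> K\<close> K_sub by auto
  qed
  have U_index: "U I \<in> index_sets (n + 1)" if "I \<noteq> {}" "I \<subseteq> K" for I
  proof -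
    have "U I \<noteq> {}"
    proof
      assume "U I = {}"
      then have "{i \<in> {1..n}. \<tau> i \<in> U I} = {}" by simp
      then show False using U_\<tau>[OF that(2)] that(1) by (simp only:)
    qed
    moreover have "U I \<subseteq> {1..n + 1}" unfolding U_def by (rule Collect_subset)
    ultimately show ?thesis unfolding index_sets_def by blast
  qed

  \<comment> \<open>Contraction of blocks and placement at representatives\<close>
  define C where "C = pull_vec (n + 1) n \<sigma>"
  define L where "L = pull_vec n (n + 1) \<tau>"
  have C_H: "C S \<in> H n" if "S \<in> H (n + 1)" for S
    unfolding C_def by (rule pull_vec_in_H[OF that]) (use \<sigma>_le in auto)
  have L_H: "L S \<in> H (n + 1)" if "S \<in> H n" for S
  proof -
    have "\<tau> i \<le> n + 1" for i
    proof (cases "i \<in> K")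
      case True
      then show ?thesis using B_mem[OF True \<tau>_B[OF True]] by simp
    qed (simp add: \<tau>_def)
    then show ?thesis unfolding L_def by (intro pull_vec_in_H[OF that]) auto
  qed
  have C_apply: "C x I = x (U I)" if "I \<in> index_sets n" for x I
    using that by (simp add: C_def pull_vec_def U_def)
  have LC: "L x (U I) = x I" if "I \<noteq> {}" "I \<subseteq> K" for x I
    unfolding L_def pull_vec_def U_\<tau>[OF that(2)] by (rule if_P[OF U_index[OF that]])

  \<comment> \<open>Stated for every function \<open>x\<close>, so that it evaluates the separation
    sums as well as the left-hand side of the lift.\<close>
  have lift_sum: "(\<Sum>J\<in>index_sets (n + 1). q' J * x J) = (\<Sum>I\<in>index_sets n. q I * x (U I))" for x
  proof -
    let ?A = "{I \<in> index_sets n. q I \<noteq> 0}"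
    have U_A: "(\<Union>i\<in>I. B i) = U I" if "I \<in> ?A" for I
      using that supp by (intro U_eq) auto
    have q': "q' J = sum q {I \<in> ?A. U I = J}" for J
      unfolding q'_def zero_lift_def by (rule sum.cong) (use U_A in auto)
    have "(\<Sum>J\<in>index_sets (n + 1). q' J * x J)
        = (\<Sum>J\<in>index_sets (n + 1). \<Sum>I\<in>{I \<in> ?A. U I = J}. q I * x (U I))"
      unfolding q' sum_distrib_right by (intro sum.cong refl) auto
    also have "\<dots> = (\<Sum>I\<in>?A. q I * x (U I))"
      by (rule sum.group) (use U_index supp in \<open>auto simp: index_sets_def\<close>)
    also have "\<dots> = (\<Sum>I\<in>index_sets n. q I * x (U I))"
      by (rule sum.mono_neutral_left) auto
    finally show ?thesis .
  qed
  have q'_C: "ineq_lhs (n + 1) q' x = ineq_lhs n q (C x)" for x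
    unfolding ineq_lhs_def lift_sum by (intro sum.cong) (simp_all add: C_apply)
  \<comment> \<open>\<open>C\<close> after \<open>L\<close> restores the entries at subsets of
    \<open>K\<close>; all other coordinates have coefficient 0 in \<open>q\<close>.\<close>
  have q_CL: "ineq_lhs n q (C (L x)) = ineq_lhs n q x" for x
    unfolding ineq_lhs_def
  proof (rule sum.cong)
    fix I assume I: "I \<in> index_sets n"
    show "q I * C (L x) I = q I * x I"
    proof (cases "q I = 0")
      case False
      have "I \<noteq> {}" using I by (simp add: index_sets_def)
      then show ?thesis using LC[OF _ supp[OF I False]] I by (simp add: C_apply)
    qed simp
  qed simp

  \<comment> \<open>Superbalancedness of the lift\<close>
  have super: "superbalanced (n + 1) q'"
    unfolding superbalanced_iff
  proof (intro allI impI)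
    fix a z assume az: "a \<le> n + 1" "z \<le> n + 1"
    have "(\<Sum>J\<in>index_sets (n + 1). if separates J a z then q' J else 0)
        = (\<Sum>J\<in>index_sets (n + 1). q' J * (if separates J a z then 1 else 0))"
      by (intro sum.cong) auto
    also have "\<dots> = (\<Sum>I\<in>index_sets n. q I * (if separates (U I) a z then 1 else 0))"
      by (rule lift_sum)
    \<comment> \<open>Each edge of the lift is contracted to an edge or a loop of the original,
      where the sum vanishes.\<close>
    also have "\<dots> = (\<Sum>I\<in>index_sets n. if separates I (\<sigma> a) (\<sigma> z) then q I else 0)"
      by (intro sum.cong refl) (simp add: sep_U[OF _ az])
    also have "\<dots> = 0" using assms(2) \<sigma>_le by (simp add: superbalanced_iff)
    finally show "(\<Sum>J\<in>index_sets (n + 1). if separates J a z then q' J else 0) = 0" .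
  qed

  \<comment> \<open>The lifted face spans its hyperplane\<close>
  let ?F = "{S \<in> H n. ineq_lhs n q S = 0}"
  let ?F' = "{S \<in> H (n + 1). ineq_lhs (n + 1) q' S = 0}"
  obtain I0 where I0: "I0 \<in> index_sets n" "q I0 \<noteq> 0"
    using facet_nonzero assms(1,3) by blast
  have F: "x \<in> span ?F" if "x \<in> cut_space n" "ineq_lhs n q x = 0" for x
  proof -
    have "affine_dim ?F = 2 ^ n - 2" using assms(3) unfolding is_facet_def by blast
    then show ?thesis using that unfolding affine_dim_face_eq_iff[of I0 n q, OF I0] by blast
  qed
  interpret L: linear L unfolding L_def by (rule linear_pull_vec)
  have L_F: "L x \<in> span ?F'" if "x \<in> span ?F" for x
    using that
  proof (induction rule: span_induct_alt)
    case base
    show ?case unfolding L.zero by (rule span_zero)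
  next
    case (step c S y)
    then have "L S \<in> ?F'" unfolding mem_Collect_eq q'_C q_CL using L_H by blast
    then have "L S \<in> span ?F'" by (rule span_base)
    then show ?case unfolding L.add L.scale using step by (intro span_add span_scale)
  qed
  \<comment> \<open>\<open>U I\<close> never separates \<open>a\<close> from \<open>z\<close>, so on
    the support of \<open>q\<close> the contraction of a vector in \<open>flat_vecs\<close> is a
    combination of edges at \<open>\<sigma> a\<close>, which puts the vector on the lifted face. The
    case \<open>\<sigma> a = 0\<close> is the sink block.\<close>
  have block: "unit_vec J \<in> span ?F'"
    if J: "J \<in> index_sets (n + 1)" and az: "a \<le> n + 1" "z \<le> n + 1" "\<sigma> a = \<sigma> z" "separates J a z"
    for J a z
  proof -
    have "flat_vecs (n + 1) a z \<subseteq> ?F'"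
    proof
      fix S assume "S \<in> flat_vecs (n + 1) a z"
      then obtain c where S: "S \<in> H (n + 1)" and c: "\<And>J. J \<in> index_sets (n + 1) \<Longrightarrow>
          \<not> separates J a z \<Longrightarrow>
          S J = (\<Sum>u\<in>{0..n + 1} - {a, z}. c u * (if separates J a u then 1 else 0))"
        by (auto simp: flat_vecs_def)
      have "ineq_lhs n q (C S) = 0"
      proof (rule ineq_lhs_flat_eq_0[OF assms(2) \<sigma>_le])
        fix I assume I: "I \<in> index_sets n" "q I \<noteq> 0"
        have "U I \<in> index_sets (n + 1)"
          using I supp by (intro U_index) (auto simp: index_sets_def)
        moreover have "\<not> separates (U I) a z"
          using sep_U[OF I(1) az(1,2)] az(3) by (simp add: separates_def)
        ultimately have "C S I
            = (\<Sum>u\<in>{0..n + 1} - {a, z}. c u * (if separates (U I) a u then 1 else 0))"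
          using c by (simp add: C_apply[OF I(1)])
        also have "\<dots> = (\<Sum>u\<in>{0..n + 1} - {a, z}. c u * (if separates I (\<sigma> a) (\<sigma> u) then 1 else 0))"
          by (intro sum.cong refl) (use sep_U[OF I(1) az(1)] in simp)
        finally show "C S I
            = (\<Sum>u\<in>{0..n + 1} - {a, z}. c u * (if separates I (\<sigma> a) (\<sigma> u) then 1 else 0))" .
      qed (rule \<sigma>_le)
      then show "S \<in> ?F'" using S unfolding mem_Collect_eq q'_C by blast
    qed
    moreover have "a \<noteq> z" using az(4) by (auto simp: separates_def)
    ultimately show ?thesis
      using unit_vec_in_span_flat_vecs[OF az(1,2) _ J az(4)] span_mono by blast
  qed
  have F': "x \<in> span ?F'" if x: "x \<in> cut_space (n + 1)" and q'x: "ineq_lhs (n + 1) q' x = 0" for x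
  proof -
    \<comment> \<open>\<open>C x\<close> lies on the hyperplane of \<open>q\<close>, so
      \<open>L (C x)\<close> is in the span. The remainder \<open>y\<close> vanishes at the unions
      of blocks that avoid the sink block, and its other entries are handled by
      \<open>block\<close>.\<close>
    define y where "y = x - L (C x)"
    have "C x \<in> cut_space n" unfolding C_def by (rule pull_vec_in_cut_space)
    then have LCx: "L (C x) \<in> span ?F'" by (intro L_F F q'x[unfolded q'_C])
    have "L (C x) \<in> cut_space (n + 1)" unfolding L_def by (rule pull_vec_in_cut_space)
    then have y: "y \<in> cut_space (n + 1)" using x by (simp add: y_def cut_space_def)
    have "y J *\<^sub>R unit_vec J \<in> span ?F'" if J: "J \<in> index_sets (n + 1)" for J
    proof (cases "\<exists>a\<le>n + 1. \<exists>z\<le>n + 1. \<sigma> a = \<sigma> z \<and> separates J a z")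
      case True
      then show ?thesis using block[OF J] by (auto intro: span_scale)
    next
      case False
      \<comment> \<open>\<open>J\<close> is now a union of blocks; it avoids the sink block because
        that block contains 0.\<close>
      have "0 \<notin> J" using J by (auto simp: index_sets_def)
      have J_sub: "J \<subseteq> {1..n + 1}" "J \<noteq> {}" using J by (auto simp: index_sets_def)
      have "\<sigma> u \<noteq> 0" if "u \<in> J" for u
      proof
        assume "\<sigma> u = 0"
        moreover have "u \<le> n + 1" using that J_sub by auto
        moreover have "separates J u 0" using that \<open>0 \<notin> J\<close> by (simp add: separates_def)
        ultimately show False using False \<sigma>_0 by (metis le0)
      qed
      then have I: "\<sigma> ` J \<subseteq> K" using \<sigma>_cases by (metis imageE subsetI)
      have "U (\<sigma> ` J) = J"
      proof (intro equalityI subsetI)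
        fix u assume "u \<in> U (\<sigma> ` J)"
        then obtain v where v: "v \<in> J" "\<sigma> u = \<sigma> v" and u: "u \<le> n + 1" by (auto simp: U_def)
        have "v \<le> n + 1" using v J_sub by auto
        then have "\<not> separates J u v" using False u v(2) by metis
        then show "u \<in> J" using v by (simp add: separates_def)
      qed (use J_sub in \<open>auto simp: U_def\<close>)
      moreover have "\<sigma> ` J \<in> index_sets n"
        using I K_sub J_sub(2) unfolding index_sets_def by blast
      ultimately have "L (C x) J = x J"
        using LC[OF _ I, of "C x"] J_sub(2) C_apply[of "\<sigma> ` J" x] by simp
      then have "y J = 0" by (simp add: y_def)
      show ?thesis unfolding \<open>y J = 0\<close> scale_zero_left by (rule span_zero)
    qed
    then have "y \<in> span ?F'"
      by (subst cut_space_expand[OF y]) (rule span_sum)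
    then have "y + L (C x) \<in> span ?F'" using LCx by (rule span_add)
    then show ?thesis by (simp add: y_def)
  qed

  \<comment> \<open>The lift defines a facet\<close>
  have "\<exists>J\<in>index_sets (n + 1). q' J \<noteq> 0"
  proof (rule ccontr)
    assume "\<not> ?thesis"
    \<comment> \<open>The left-hand side of the lift at the lifted unit vector of \<open>I0\<close>
      is \<open>q I0\<close>, so the collected coefficients cannot all cancel.\<close>
    then have "ineq_lhs (n + 1) q' (L (unit_vec I0)) = 0"
      unfolding ineq_lhs_def by (intro sum.neutral) auto
    then show False using I0 unfolding q'_C q_CL ineq_lhs_unit_vec[OF I0(1)] by blast
  qed
  then obtain J0 where J0: "J0 \<in> index_sets (n + 1)" "q' J0 \<noteq> 0" by blast
  have "q' \<in> cut_space (n + 1)"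
    unfolding cut_space_def
  proof (intro CollectI allI impI)
    fix J assume J: "J \<notin> index_sets (n + 1)"
    have "{I. I \<in> index_sets n \<and> q I \<noteq> 0 \<and> (\<Union>i\<in>I. B i) = J} = {}"
    proof (intro equals0I)
      fix I assume "I \<in> {I. I \<in> index_sets n \<and> q I \<noteq> 0 \<and> (\<Union>i\<in>I. B i) = J}"
      then have I: "I \<in> index_sets n" "q I \<noteq> 0" "(\<Union>i\<in>I. B i) = J" by auto
      then have "I \<noteq> {}" "I \<subseteq> K" using supp by (simp_all add: index_sets_def)
      then show False using U_index[of I] U_eq[of I] I(3) J by simp
    qed
    then show "q' J = 0" unfolding q'_def zero_lift_def by (simp only: sum.empty)
  qed
  moreover have "ineq_lhs (n + 1) q' S \<ge> 0" if "S \<in> H (n + 1)" for S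
    using assms(3) C_H[OF that] unfolding q'_C is_facet_def by blast
  moreover have "affine_dim ?F' = 2 ^ (n + 1) - 2"
    using F' unfolding affine_dim_face_eq_iff[of J0 "n + 1" q', OF J0] by blast
  ultimately have "is_facet (n + 1) q'" unfolding is_facet_def by blast
  then show ?thesis using super unfolding q'_def by blast
qed

end
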